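(* For $|q|<1$, $$\mathrm{C}\Phi_8(q)=\frac{1}{(q;q)_\infty^8}\Big(\Theta_3^7(q^4)+28\Theta_3^6(q^4)\Theta_2(q^4)+105\Theta_3^5(q^4)\Theta_2^2(q^4)+112\Theta_3^4(q^4)\Theta_2^3(q^4)$$ $$+147\Theta_3^3(q^4)\Theta_2^4(q^4)+84\Theta_3^2(q^4)\Theta_2^5(q^4)+35\Theta_3(q^4)\Theta_2^6(q^4)\Big).$$
   Context: A $k$-colored generalized Frobenius symbol is a two-row array with $d\ge 0$ columns whose entries are colored nonnegative integers $\ell_c$ ($\ell\ge 0$, color $c\in\{1,\dots,k\}$), each row strictly decreasing with respect to the total order $0_1\prec 0_2\prec\cdots\prec 0_k\prec 1_1\prec\cdots\prec 1_k\prec 2_1\prec\cdots$. It is a $k$-colored generalized Frobenius partition of $n=d+\sum(\text{integer values of all entries})$. $c\phi_k(n)$ is the number of such partitions of $n$ (with $c\phi_k(0)=1$), and $\mathrm{C}\Phi_k(q)=\sum_{n\ge0}c\phi_k(n)q^n$. $(a;q)_\infty=\prod_{j\ge1}(1-aq^{j-1})$, $\Theta_3(x)=\sum_{j\in\mathbf Z}x^{j^2}$ and $\Theta_2(x)=\sum_{j\in\mathbf Z}x^{(j+1/2)^2}$. *)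

theory Defs
  imports "HOL-Analysis.Analysis"
begin

text \<open>The pair \<open>(l, c)\<close> encodes the coloured integer \<open>l\<^sub>c\<close>.\<close>

definition colored_less :: "nat \<times> nat \<Rightarrow> nat \<times> nat \<Rightarrow> bool" where
  "colored_less x y \<longleftrightarrow> fst x < fst y \<or> (fst x = fst y \<and> snd x < snd y)"

definition frobenius_row :: "nat \<Rightarrow> (nat \<times> nat) list \<Rightarrow> bool" where
  "frobenius_row k xs \<longleftrightarrow>
     (\<forall>x \<in> set xs. snd x \<in> {1..k}) \<and> sorted_wrt (\<lambda>x y. colored_less y x) xs"

definition frobenius_symbols :: "nat \<Rightarrow> ((nat \<times> nat) list \<times> (nat \<times> nat) list) set" where
  "frobenius_symbols k =
     {(xs, ys). length xs = length ys \<and> frobenius_row k xs \<and> frobenius_row k ys}"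

definition frobenius_size :: "(nat \<times> nat) list \<times> (nat \<times> nat) list \<Rightarrow> nat" where
  "frobenius_size s = length (fst s) + sum_list (map fst (fst s)) + sum_list (map fst (snd s))"

definition frobenius_partitions :: "nat \<Rightarrow> nat \<Rightarrow> ((nat \<times> nat) list \<times> (nat \<times> nat) list) set" where
  "frobenius_partitions k n = {s \<in> frobenius_symbols k. frobenius_size s = n}"

definition cphi :: "nat \<Rightarrow> nat \<Rightarrow> nat" where
  "cphi k n = card (frobenius_partitions k n)"

lemma finite_frobenius_partitions: "finite (frobenius_partitions k n)"
proof -
  let ?L = "{xs. set xs \<subseteq> {..n} \<times> {1..k} \<and> length xs \<le> n}"
  have "s \<in> ?L \<times> ?L" if "s \<in> frobenius_partitions k n" for s
  proof -
    obtain xs ys where s: "s = (xs, ys)" by fastforce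
    have n: "n = length xs + sum_list (map fst xs) + sum_list (map fst ys)"
      and l: "length xs = length ys"
      and c: "\<forall>x \<in> set xs. snd x \<in> {1..k}" "\<forall>x \<in> set ys. snd x \<in> {1..k}"
      using that unfolding s frobenius_partitions_def frobenius_symbols_def
        frobenius_size_def frobenius_row_def by auto
    have "fst x \<le> sum_list (map fst zs)" if "x \<in> set zs" for x :: "nat \<times> nat" and zs
      using that by (intro member_le_sum_list) auto
    hence "\<forall>x \<in> set xs. fst x \<le> n" "\<forall>x \<in> set ys. fst x \<le> n"
      using n by (meson le_add1 le_add2 le_trans)+
    thus ?thesis using c l n unfolding s by (auto simp: mem_Times_iff)
  qed
  moreover have "finite (?L \<times> ?L)"
    by (intro finite_cartesian_product finite_lists_length_le) auto
  ultimately show ?thesis by (meson finite_subset subsetI)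
qed

lemma cphi_0: "cphi k 0 = 1"
proof -
  have "frobenius_partitions k 0 = {([], [])}"
    by (auto simp: frobenius_partitions_def frobenius_symbols_def frobenius_size_def
        frobenius_row_def)
  thus ?thesis by (simp add: cphi_def)
qed

definition CPhi :: "nat \<Rightarrow> complex \<Rightarrow> complex" where
  "CPhi k q = (\<Sum>n. of_nat (cphi k n) * q ^ n)"

definition qpoch_inf :: "complex \<Rightarrow> complex \<Rightarrow> complex" where
  "qpoch_inf a q = prodinf (\<lambda>j. 1 - a * q ^ j)"

definition Theta3 :: "complex \<Rightarrow> complex" where
  "Theta3 x = (\<Sum>\<^sub>\<infinity>j::int. x ^ nat (j\<^sup>2))"

text \<open>
  The exponents \<open>(j + 1/2)\<^sup>2 = (2 j + 1)\<^sup>2 / 4\<close> of \<open>\<Theta>\<^sub>2(x)\<close> are not integers, so for complex \<open>x\<close> the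
  series depends on the choice of a fourth root of \<open>x\<close>.  The argument \<open>r\<close> below is that root:
  \<open>Theta2_root r\<close> is \<open>\<Theta>\<^sub>2(x)\<close> for \<open>x = r\<^sup>4\<close> and \<open>x\<^bsup>1/4\<^esup> = r\<close>.  In particular \<open>\<Theta>\<^sub>2(q\<^sup>4)\<close>, a power
  series in \<open>q\<close>, is \<open>Theta2_root q\<close>; the principal branch of \<open>(q\<^sup>4)\<^bsup>1/4\<^esup>\<close> would be wrong for
  general complex \<open>q\<close>.
\<close>

definition Theta2_root :: "complex \<Rightarrow> complex" where
  "Theta2_root r = (\<Sum>\<^sub>\<infinity>j::int. r ^ nat ((2 * j + 1)\<^sup>2))"

lemma Theta2_root_exp:
  "Theta2_root (exp (w / 4)) = (\<Sum>\<^sub>\<infinity>j::int. exp (w * (of_int j + 1 / 2)\<^sup>2))"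
  unfolding Theta2_root_def
proof (rule infsum_cong)
  fix j :: int
  have "exp (w / 4) ^ nat ((2 * j + 1)\<^sup>2) = exp (of_nat (nat ((2 * j + 1)\<^sup>2)) * (w / 4))"
    by (simp only: exp_of_nat_mult)
  also have "(of_nat (nat ((2 * j + 1)\<^sup>2)) :: complex) = (2 * of_int j + 1)\<^sup>2"
    by (simp add: of_nat_nat)
  also have "(2 * of_int j + 1)\<^sup>2 * (w / 4) = w * (of_int j + 1 / 2)\<^sup>2"
    by (simp add: power2_eq_square field_simps)
  finally show "exp (w / 4) ^ nat ((2 * j + 1)\<^sup>2) = exp (w * (of_int j + 1 / 2)\<^sup>2)" .
qed

lemma Theta2_root_real:
  assumes "0 \<le> (q::real)"
  shows "Theta2_root (of_real q) =
    (\<Sum>\<^sub>\<infinity>j::int. of_real ((q ^ 4) powr ((real_of_int j + 1 / 2)\<^sup>2)))"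
  unfolding Theta2_root_def
proof (rule infsum_cong)
  fix j :: int
  have odd: "2 * j + 1 \<noteq> 0" by presburger
  have "(q ^ 4) powr ((real_of_int j + 1 / 2)\<^sup>2) = q ^ nat ((2 * j + 1)\<^sup>2)"
  proof (cases "q = 0")
    case True
    thus ?thesis using odd by (simp add: power_0_left)
  next
    case False
    hence "q > 0" using assms by simp
    have "(q ^ 4) powr ((real_of_int j + 1 / 2)\<^sup>2) = q powr (4 * (real_of_int j + 1 / 2)\<^sup>2)"
      using \<open>q > 0\<close> powr_powr[of q 4 "(real_of_int j + 1 / 2)\<^sup>2"] by simp
    also have "4 * (real_of_int j + 1 / 2)\<^sup>2 = (2 * real_of_int j + 1)\<^sup>2"
      by (simp add: power2_eq_square field_simps)
    also have "\<dots> = real (nat ((2 * j + 1)\<^sup>2))"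
      by (simp add: of_nat_nat)
    finally show ?thesis using \<open>q > 0\<close> by (simp only: powr_realpow)
  qed
  thus "(of_real q :: complex) ^ nat ((2 * j + 1)\<^sup>2) =
      of_real ((q ^ 4) powr ((real_of_int j + 1 / 2)\<^sup>2))" by simp
qed

end

theory Submission
  imports Defs
begin

text \<open>
  Splitting both rows of a symbol by colour turns it into a family of pairs \<open>(X\<^sub>c, Y\<^sub>c)\<close> of finite
  sets of naturals with \<open>\<Sum>\<^sub>c (|X\<^sub>c| - |Y\<^sub>c|) = 0\<close>.  For one colour, the pairs with \<open>|X| - |Y| = m\<close>
  have generating function \<open>s\<^bsup>m\<^sup>2\<^esup> / (q;q)\<^sub>\<infinity>\<close>, where \<open>s\<^sup>2 = q\<close> and an entry \<open>l\<close> has weight \<open>2 l + 1\<close>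
  (the Jacobi triple product, obtained here as a limit of \<open>q\<close>-binomial coefficients).
  Doubling the number of colours convolves these functions of \<open>m\<close>.  Since
  \<open>b\<^sup>2 + (a - b)\<^sup>2 = (a\<^sup>2 + (2 b - a)\<^sup>2) / 2\<close>, every doubling again produces Gaussians in \<open>a\<close> times
  theta constants depending only on the parity of \<open>a\<close>.  After three doublings, charge \<open>0\<close> gives a
  polynomial in theta constants at \<open>q\<^bsup>1/8\<^esup>, q\<^bsup>1/4\<^esup>, q\<^bsup>1/2\<^esup>, q\<close>, which the classical duplication
  formulas reduce to \<open>\<Theta>\<^sub>3(q\<^sup>4)\<close> and \<open>\<Theta>\<^sub>2(q\<^sup>4)\<close>.  Working with \<open>t\<close> such that \<open>t\<^sup>8 = q\<close> keeps
  all exponents integral.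
\<close>

section \<open>Theta constants by parity class\<close>

text \<open>Summability over the complex numbers is absolute, so the norms of the products are
  summable over the rectangle and the iterated sum computes the total.\<close>

lemma has_sum_Times_complex:
  fixes f :: "'a \<Rightarrow> complex" and g :: "'b \<Rightarrow> complex"
  assumes f: "(f has_sum a) A" and g: "(g has_sum b) B"
  shows "((\<lambda>(x, y). f x * g y) has_sum (a * b)) (A \<times> B)"
proof -
  have fs: "(\<lambda>x. norm (f x)) summable_on A" and gs: "(\<lambda>y. norm (g y)) summable_on B"
    using f g by (auto simp: has_sum_imp_summable simp flip: summable_on_iff_abs_summable_on_complex)
  have "(\<lambda>z. norm (case z of (x, y) \<Rightarrow> f x * g y)) summable_on (A \<times> B)"
  proof (subst Infinite_Sum.abs_summable_on_Sigma_iff, intro conjI ballI)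
    fix x
    show "(\<lambda>y. norm (case (x, y) of (x, y) \<Rightarrow> f x * g y)) summable_on B"
      using summable_on_cmult_right[OF gs, of "norm (f x)"] by (simp add: norm_mult)
  next
    have "(\<lambda>x. norm (f x) * (\<Sum>\<^sub>\<infinity>y\<in>B. norm (g y))) summable_on A"
      by (rule summable_on_cmult_left[OF fs])
    thus "(\<lambda>x. norm (\<Sum>\<^sub>\<infinity>y\<in>B. norm (case (x, y) of (x, y) \<Rightarrow> f x * g y))) summable_on A"
      by (simp add: norm_mult infsum_cmult_right' abs_mult infsum_nonneg)
  qed
  hence "(\<lambda>(x, y). f x * g y) summable_on (A \<times> B)"
    by (rule abs_summable_summable)
  moreover have "((\<lambda>y. case (x, y) of (x, y) \<Rightarrow> f x * g y) has_sum (f x * b)) B" for x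
    using has_sum_cmult_right[OF g] by simp
  moreover have "((\<lambda>x. f x * b) has_sum (a * b)) A"
    by (rule has_sum_cmult_left[OF f])
  ultimately show ?thesis
    by (rule has_sum_SigmaI[rotated 2])
qed

lemma has_sum_int_parity:
  fixes f :: "int \<Rightarrow> complex"
  assumes "(f has_sum a) {n. even n}" "(f has_sum b) {n. odd n}"
  shows "(f has_sum (a + b)) UNIV"
proof -
  have "{n::int. even n} \<union> {n. odd n} = UNIV" "{n::int. even n} \<inter> {n. odd n} = {}" by auto
  thus ?thesis using has_sum_Un_disjoint[OF assms] by simp
qed

text \<open>Since |n| <= n^2, a two-sided geometric series in \<open>norm r\<close> dominates; it is
  assembled from two half-lines.\<close>

lemma summable_on_power_square:
  fixes r :: complex
  assumes r: "norm r < 1"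
  shows "(\<lambda>n::int. r ^ nat (n\<^sup>2)) summable_on A"
proof -
  define p where "p = norm r"
  have p: "0 \<le> p" "p < 1" using r by (auto simp: p_def)
  have "(\<lambda>n::nat. p ^ n) summable_on UNIV"
    using p by (intro summable_nonneg_imp_summable_on) (auto intro: summable_geometric)
  hence "(\<lambda>n::int. p ^ nat \<bar>n\<bar>) summable_on range int"
        "(\<lambda>n::int. p ^ nat \<bar>n\<bar>) summable_on range (\<lambda>n. - int n)"
    by (subst summable_on_reindex; simp add: inj_on_def o_def)+
  hence "(\<lambda>n::int. p ^ nat \<bar>n\<bar>) summable_on (range int \<union> range (\<lambda>n. - int n))"
    by (rule summable_on_union)
  also have "range int \<union> range (\<lambda>n. - int n) = UNIV"
  proof -
    have "n \<in> range int \<union> range (\<lambda>n. - int n)" for n :: int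
      by (cases n rule: int_cases2) auto
    thus ?thesis by blast
  qed
  finally have *: "(\<lambda>n::int. p ^ nat \<bar>n\<bar>) summable_on UNIV" .
  have "norm (r ^ nat (n\<^sup>2)) \<le> p ^ nat \<bar>n\<bar>" for n :: int
  proof -
    have "\<bar>n\<bar> \<le> \<bar>n\<bar> * \<bar>n\<bar>" using mult_left_mono[of 1 "\<bar>n\<bar>" "\<bar>n\<bar>"] by (cases "n = 0") auto
    hence "nat \<bar>n\<bar> \<le> nat (n\<^sup>2)" by (simp add: power2_eq_square nat_mono)
    thus ?thesis using p by (simp add: norm_power p_def power_decreasing)
  qed
  hence "(\<lambda>n::int. norm (r ^ nat (n\<^sup>2))) summable_on UNIV"
    by (intro Infinite_Sum.abs_summable_on_comparison_test'[OF *]) auto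
  hence "(\<lambda>n::int. r ^ nat (n\<^sup>2)) summable_on UNIV" by (rule abs_summable_summable)
  thus ?thesis by (rule summable_on_subset_banach) auto
qed

text \<open>Classically, class 0 is theta_3 at r^4 and class 1 is theta_2 at r^4, with r as the
  fourth root. Only the parity of \<open>a\<close> counts; an integer index lets parities be handled
  by arithmetic such as \<open>a - b\<close>.\<close>

definition theta_class :: "int \<Rightarrow> complex \<Rightarrow> complex" where
  "theta_class a r = (\<Sum>\<^sub>\<infinity>n | even n \<longleftrightarrow> even a. r ^ nat (n\<^sup>2))"

lemma has_sum_theta_class:
  assumes "norm r < 1"
  shows "((\<lambda>n. r ^ nat (n\<^sup>2)) has_sum theta_class a r) {n. even n \<longleftrightarrow> even a}"
  unfolding theta_class_def using summable_on_power_square[OF assms] by (rule has_sum_infsum)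

lemma theta_class_even: "even a \<Longrightarrow> theta_class a r = theta_class 0 r"
  and theta_class_odd: "odd a \<Longrightarrow> theta_class a r = theta_class 1 r"
  by (simp_all add: theta_class_def)

lemma has_sum_theta_classes:
  assumes "norm r < 1"
  shows "((\<lambda>n. r ^ nat (n\<^sup>2)) has_sum theta_class 0 r) {n. even n}"
        "((\<lambda>n. r ^ nat (n\<^sup>2)) has_sum theta_class 1 r) {n. odd n}"
  using has_sum_theta_class[OF assms, of 0] has_sum_theta_class[OF assms, of 1] by simp_all

text \<open>The even integers 2n contribute r^(4 n^2), a full theta series in r^4, which is then
  split by parity.\<close>

lemma theta_class_add:
  assumes r: "norm r < 1"
  shows "theta_class 0 r = theta_class 0 (r ^ 4) + theta_class 1 (r ^ 4)"
proof -
  have r4: "norm (r ^ 4) < 1" using r by (simp add: norm_power power_less_one_iff)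
  have "((\<lambda>n. (r ^ 4) ^ nat (n\<^sup>2)) has_sum (theta_class 0 (r ^ 4) + theta_class 1 (r ^ 4))) UNIV"
    by (intro has_sum_int_parity has_sum_theta_classes r4)
  also have "?this \<longleftrightarrow> ((\<lambda>n. r ^ nat (n\<^sup>2)) has_sum (theta_class 0 (r ^ 4) + theta_class 1 (r ^ 4))) {n. even n}"
  proof (rule has_sum_reindex_bij_witness[of _ "\<lambda>n. n div 2" "\<lambda>n. 2 * n"])
    fix n :: int
    have "nat ((2 * n)\<^sup>2) = 4 * nat (n\<^sup>2)"
      by (rule int_int_eq[THEN iffD1]) (simp add: power2_eq_square)
    thus "r ^ nat ((2 * n)\<^sup>2) = (r ^ 4) ^ nat (n\<^sup>2)" by (simp add: power_mult)
  qed auto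
  finally show ?thesis using has_sum_theta_classes(1)[OF r] has_sum_unique by blast
qed

text \<open>The substitution m = u + v, n = u - v describes the pairs of equal parity and gives m^2
  + n^2 = 2 (u^2 + v^2). That m lies in the class of \<open>a\<close> becomes that v lies in the
  class of \<open>a - u\<close>, so the parity of u selects the second factor.\<close>

lemma theta_class_square:
  assumes t: "norm t < 1"
  shows "theta_class a t ^ 2 = theta_class 0 (t\<^sup>2) * theta_class a (t\<^sup>2)
    + theta_class 1 (t\<^sup>2) * theta_class (a - 1) (t\<^sup>2)"
proof -
  let ?r = "t\<^sup>2"
  have r: "norm ?r < 1" using t by (simp add: norm_power power_less_one_iff)
  let ?S = "{n. even n \<longleftrightarrow> even a} \<times> {n. even n \<longleftrightarrow> even a}"
  let ?T = "SIGMA u:UNIV. {v. even v \<longleftrightarrow> even (a - u)}"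
  have "((\<lambda>(m, n). t ^ nat (m\<^sup>2) * t ^ nat (n\<^sup>2)) has_sum (theta_class a t * theta_class a t)) ?S"
    by (intro has_sum_Times_complex has_sum_theta_class t)
  also have "?this \<longleftrightarrow> ((\<lambda>(u, v). ?r ^ nat (u\<^sup>2) * ?r ^ nat (v\<^sup>2)) has_sum
      (theta_class a t * theta_class a t)) ?T"
  proof (rule has_sum_reindex_bij_witness
      [of _ "\<lambda>(u, v). (u + v, u - v)" "\<lambda>(m, n). ((m + n) div 2, (m - n) div 2)"], goal_cases)
    case (1 x) thus ?case by auto presburger+
  next
    case (2 x) thus ?case by auto presburger+
  next
    case (3 x) thus ?case by auto
  next
    case (4 x) thus ?case by auto
  next
    case (5 x)
    obtain m n where x: "x = (m, n)" by fastforce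
    define u v where "u = (m + n) div 2" and "v = (m - n) div 2"
    have mn: "m = u + v" "n = u - v" using 5 unfolding x u_def v_def by auto presburger+
    have "2 * nat (u\<^sup>2) + 2 * nat (v\<^sup>2) = nat (m\<^sup>2) + nat (n\<^sup>2)"
      unfolding mn by (rule int_int_eq[THEN iffD1], simp, simp add: power2_eq_square algebra_simps)
    thus ?case unfolding x
      by (simp flip: u_def v_def power_mult power_add)
  qed simp
  finally have 1: "((\<lambda>(u, v). ?r ^ nat (u\<^sup>2) * ?r ^ nat (v\<^sup>2)) has_sum
      (theta_class a t * theta_class a t)) ?T" .
  have 2: "((\<lambda>u. ?r ^ nat (u\<^sup>2) * theta_class (a - u) ?r) has_sum (theta_class a t * theta_class a t)) UNIV"
  proof (rule has_sum_SigmaD[OF 1])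
    fix u :: int
    show "((\<lambda>v. case (u, v) of (u, v) \<Rightarrow> ?r ^ nat (u\<^sup>2) * ?r ^ nat (v\<^sup>2)) has_sum
        ?r ^ nat (u\<^sup>2) * theta_class (a - u) ?r) {v. even v \<longleftrightarrow> even (a - u)}"
      using has_sum_cmult_right[OF has_sum_theta_class[OF r, of "a - u"]] by simp
  qed
  have "((\<lambda>u. ?r ^ nat (u\<^sup>2) * theta_class (a - u) ?r) has_sum
      (theta_class 0 ?r * theta_class a ?r + theta_class 1 ?r * theta_class (a - 1) ?r)) UNIV"
  proof (rule has_sum_int_parity)
    have "((\<lambda>u. ?r ^ nat (u\<^sup>2) * theta_class a ?r) has_sum theta_class 0 ?r * theta_class a ?r) {n. even n}"
      by (intro has_sum_cmult_left has_sum_theta_classes r)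
    thus "((\<lambda>u. ?r ^ nat (u\<^sup>2) * theta_class (a - u) ?r) has_sum theta_class 0 ?r * theta_class a ?r) {n. even n}"
      by (rule has_sum_cong[THEN iffD1, rotated]) (simp add: theta_class_def)
    have "((\<lambda>u. ?r ^ nat (u\<^sup>2) * theta_class (a - 1) ?r) has_sum theta_class 1 ?r * theta_class (a - 1) ?r) {n. odd n}"
      by (intro has_sum_cmult_left has_sum_theta_classes r)
    thus "((\<lambda>u. ?r ^ nat (u\<^sup>2) * theta_class (a - u) ?r) has_sum theta_class 1 ?r * theta_class (a - 1) ?r) {n. odd n}"
      by (rule has_sum_cong[THEN iffD1, rotated]) (simp add: theta_class_def)
  qed
  from has_sum_unique[OF 2 this] show ?thesis by (simp only: power2_eq_square)
qed

text \<open>With x = t^4 these are the classical duplication formulas theta_3(x)^2 = theta_3(x^2)^2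
  + theta_2(x^2)^2 and theta_2(x)^2 = 2 theta_3(x^2) theta_2(x^2).\<close>

lemma theta_class_0_square:
  "norm t < 1 \<Longrightarrow> theta_class 0 t ^ 2 = theta_class 0 (t\<^sup>2) ^ 2 + theta_class 1 (t\<^sup>2) ^ 2"
  and theta_class_1_square:
  "norm t < 1 \<Longrightarrow> theta_class 1 t ^ 2 = 2 * theta_class 0 (t\<^sup>2) * theta_class 1 (t\<^sup>2)"
  using theta_class_square[of t 0] theta_class_square[of t 1] theta_class_odd[of "-1" "t\<^sup>2"]
  by (simp_all add: power2_eq_square)

lemma Theta3_eq_theta_class:
  "Theta3 (q ^ 4) = theta_class 0 q"
proof -
  have "infsum (\<lambda>n. (q ^ 4) ^ nat (n\<^sup>2)) UNIV = infsum (\<lambda>n. q ^ nat (n\<^sup>2)) {n. even n}"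
  proof (rule infsum_reindex_bij_witness[of _ "\<lambda>n. n div 2" "\<lambda>n. 2 * n"])
    fix n :: int
    have "nat ((2 * n)\<^sup>2) = 4 * nat (n\<^sup>2)"
      by (rule int_int_eq[THEN iffD1]) (simp add: power2_eq_square)
    thus "q ^ nat ((2 * n)\<^sup>2) = (q ^ 4) ^ nat (n\<^sup>2)" by (simp add: power_mult)
  qed auto
  thus ?thesis by (simp add: Theta3_def theta_class_def)
qed

lemma Theta2_root_eq_theta_class: "Theta2_root q = theta_class 1 q"
proof -
  have "infsum (\<lambda>n. q ^ nat ((2 * n + 1)\<^sup>2)) UNIV = infsum (\<lambda>n. q ^ nat (n\<^sup>2)) {n. odd n}"
    by (rule infsum_reindex_bij_witness[of _ "\<lambda>n. n div 2" "\<lambda>n. 2 * n + 1"]) auto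
  thus ?thesis by (simp add: Theta2_root_def theta_class_def)
qed

text \<open>Completing the square with n = 2 b - a, which runs over exactly the integers of the
  parity of \<open>a\<close>; the squared base clears the resulting factor 1/2.\<close>

lemma has_sum_square_convolution:
  assumes w: "norm w < 1"
  shows "((\<lambda>b. (w\<^sup>2) ^ nat (b\<^sup>2) * (w\<^sup>2) ^ nat ((a - b)\<^sup>2)) has_sum
    w ^ nat (a\<^sup>2) * theta_class a w) UNIV"
proof -
  have "((\<lambda>n. w ^ nat (a\<^sup>2) * w ^ nat (n\<^sup>2)) has_sum w ^ nat (a\<^sup>2) * theta_class a w) {n. even n \<longleftrightarrow> even a}"
    by (intro has_sum_cmult_right has_sum_theta_class w)
  also have "?this \<longleftrightarrow> ?thesis"
  proof (rule has_sum_reindex_bij_witness[of _ "\<lambda>b. 2 * b - a" "\<lambda>n. (n + a) div 2"], goal_cases)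
    case (5 n)
    define b where "b = (n + a) div 2"
    have n: "n = 2 * b - a" using 5 unfolding b_def by auto
    have "2 * nat (b\<^sup>2) + 2 * nat ((a - b)\<^sup>2) = nat (a\<^sup>2) + nat (n\<^sup>2)"
      unfolding n by (rule int_int_eq[THEN iffD1], simp, simp add: power2_eq_square algebra_simps)
    thus ?case
      by (simp flip: b_def power_mult power_add)
  qed auto
  finally show ?thesis .
qed

text \<open>For an even total 2 k, centring at b = k + n gives b^2 + (2 k - b)^2 = 2 (k^2 + n^2), so
  no square root of \<open>w\<close> is needed and a parity condition on b becomes one on n. This
  serves summands whose theta factors depend on the parity of b.\<close>

lemma has_sum_square_convolution_parity:
  assumes w: "norm w < 1"
  shows "((\<lambda>b. w ^ nat (b\<^sup>2) * w ^ nat ((2 * k - b)\<^sup>2)) has_sum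
    (w\<^sup>2) ^ nat (k\<^sup>2) * theta_class (e - k) (w\<^sup>2)) {b. even b \<longleftrightarrow> even e}"
proof -
  have w2: "norm (w\<^sup>2) < 1" using w by (simp add: norm_power power_less_one_iff)
  have "((\<lambda>n. (w\<^sup>2) ^ nat (k\<^sup>2) * (w\<^sup>2) ^ nat (n\<^sup>2)) has_sum (w\<^sup>2) ^ nat (k\<^sup>2) * theta_class (e - k) (w\<^sup>2))
      {n. even n \<longleftrightarrow> even (e - k)}"
    by (intro has_sum_cmult_right has_sum_theta_class w2)
  also have "?this \<longleftrightarrow> ?thesis"
  proof (rule has_sum_reindex_bij_witness[of _ "\<lambda>b. b - k" "\<lambda>n. n + k"], goal_cases)
    case (5 n)
    have "nat ((n + k)\<^sup>2) + nat ((2 * k - (n + k))\<^sup>2) = 2 * nat (k\<^sup>2) + 2 * nat (n\<^sup>2)"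
      by (rule int_int_eq[THEN iffD1], simp, simp add: power2_eq_square algebra_simps)
    thus ?case
      by (simp only: power_mult [symmetric] power_add [symmetric])
  qed auto
  finally show ?thesis .
qed

section \<open>Coloured states and their charge\<close>

text \<open>A state is the pair of sets of coloured entries of the two rows of a symbol; the rows may have
  different lengths.\<close>

type_synonym state = "(nat \<times> nat) set \<times> (nat \<times> nat) set"

definition states :: "nat set \<Rightarrow> state set" where
  "states C = {(X, Y). finite X \<and> finite Y \<and> (\<forall>x\<in>X \<union> Y. snd x \<in> C)}"

lemma mem_states_iff:
  "p \<in> states C \<longleftrightarrow> finite (fst p) \<and> finite (snd p) \<and> (\<forall>x\<in>fst p. snd x \<in> C) \<and> (\<forall>x\<in>snd p. snd x \<in> C)"
  by (auto simp: states_def case_prod_unfold)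

definition charge :: "state \<Rightarrow> int" where
  "charge p = int (card (fst p)) - int (card (snd p))"

text \<open>An entry l counts as l + 1/2, doubled to stay integral. The d in the size of a symbol is
  thereby shared evenly between the two rows.\<close>

definition weight :: "state \<Rightarrow> nat" where
  "weight p = (\<Sum>x\<in>fst p. 2 * fst x + 1) + (\<Sum>x\<in>snd p. 2 * fst x + 1)"

definition charge_states :: "nat set \<Rightarrow> int \<Rightarrow> state set" where
  "charge_states C m = {p \<in> states C. charge p = m}"

definition charge_gf :: "nat set \<Rightarrow> complex \<Rightarrow> int \<Rightarrow> complex" where
  "charge_gf C s m = (\<Sum>\<^sub>\<infinity>p\<in>charge_states C m. s ^ weight p)"

text \<open>The sum over subsets factors as the product of 1 + p^(2 l + 1), which is at most the
  exponential of a geometric series. The bound is uniform in \<open>n\<close>.\<close>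

lemma sum_Pow_power_le:
  fixes p :: real
  assumes p: "0 \<le> p" "p < 1" and C: "finite C"
  shows "(\<Sum>X\<in>Pow ({..<n} \<times> C). p ^ (\<Sum>x\<in>X. 2 * fst x + 1)) \<le> exp (real (card C) / (1 - p))"
proof -
  let ?U = "{..<n} \<times> C"
  have fin: "finite ?U" using C by simp
  have "(\<Sum>X\<in>Pow ?U. p ^ (\<Sum>x\<in>X. 2 * fst x + 1)) = (\<Sum>X\<in>Pow ?U. \<Prod>x\<in>X. p ^ (2 * fst x + 1))"
    by (simp only: power_sum)
  also have "\<dots> = (\<Prod>x\<in>?U. p ^ (2 * fst x + 1) + 1)"
    by (subst prod_add[OF fin]) simp
  also have "\<dots> \<le> (\<Prod>x\<in>?U. exp (p ^ fst x))"
  proof (rule prod_mono, intro conjI)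
    fix x :: "nat \<times> 'a"
    have "p ^ (2 * fst x + 1) \<le> p ^ fst x" using p by (intro power_decreasing) auto
    thus "p ^ (2 * fst x + 1) + 1 \<le> exp (p ^ fst x)"
      using exp_ge_add_one_self[of "p ^ fst x"] by linarith
    show "0 \<le> p ^ (2 * fst x + 1) + 1" using p by simp
  qed
  also have "\<dots> = exp (\<Sum>x\<in>?U. p ^ fst x)" using fin by (simp add: exp_sum)
  also have "(\<Sum>x\<in>?U. p ^ fst x) = (\<Sum>i<n. \<Sum>c\<in>C. p ^ i)"
    by (subst sum.cartesian_product) (simp add: case_prod_unfold)
  also have "\<dots> = real (card C) * (\<Sum>i<n. p ^ i)" by (simp add: sum_distrib_left)
  also have "(\<Sum>i<n. p ^ i) \<le> 1 / (1 - p)"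
    using p sum_le_suminf[of "\<lambda>i. p ^ i" "{..<n}"] suminf_geometric[of p]
    by (simp add: summable_geometric)
  finally show ?thesis by (simp add: mult_left_mono)
qed

lemma finite_states_bounded:
  assumes "F \<subseteq> states C" "finite F"
  obtains n where "F \<subseteq> Pow ({..<n} \<times> C) \<times> Pow ({..<n} \<times> C)"
proof -
  let ?E = "\<Union>p\<in>F. fst ` fst p \<union> fst ` snd p"
  have "finite ?E" using assms by (auto simp: states_def)
  then obtain n where n: "\<forall>i\<in>?E. i < n"
    using finite_nat_set_iff_bounded by blast
  have "F \<subseteq> Pow ({..<n} \<times> C) \<times> Pow ({..<n} \<times> C)"
  proof
    fix p assume p: "p \<in> F"
    hence "p \<in> states C" using assms by auto
    moreover have "fst x < n" if "x \<in> fst p \<or> x \<in> snd p" for x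
      using n p that by blast
    ultimately show "p \<in> Pow ({..<n} \<times> C) \<times> Pow ({..<n} \<times> C)"
      unfolding mem_states_iff mem_Times_iff by fastforce
  qed
  thus ?thesis by (rule that)
qed

text \<open>Every finite set of states lies in a box, where the sum of norms factors into one sum
  for each row, both bounded independently of the box.\<close>

lemma summable_on_states:
  fixes s :: complex
  assumes s: "norm s < 1" and C: "finite C"
  shows "(\<lambda>p. s ^ weight p) summable_on states C"
proof -
  define p where "p = norm s"
  have p: "0 \<le> p" "p < 1" using s by (auto simp: p_def)
  let ?B = "exp (real (card C) / (1 - p))"
  have "(\<lambda>z. p ^ weight z) summable_on states C"
  proof (rule nonneg_bdd_above_summable_on, use p in simp, rule bdd_aboveI2)
    fix F assume "F \<in> {F. F \<subseteq> states C \<and> finite F}"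
    hence F: "F \<subseteq> states C" "finite F" by auto
    then obtain n where n: "F \<subseteq> Pow ({..<n} \<times> C) \<times> Pow ({..<n} \<times> C)"
      by (rule finite_states_bounded)
    let ?P = "Pow ({..<n} \<times> C)"
    let ?w = "\<lambda>X. p ^ (\<Sum>x\<in>X. 2 * fst x + 1)"
    have "(\<Sum>z\<in>F. p ^ weight z) \<le> (\<Sum>z\<in>?P \<times> ?P. p ^ weight z)"
      using n p C by (intro sum_mono2) auto
    also have "\<dots> = (\<Sum>X\<in>?P. ?w X) * (\<Sum>Y\<in>?P. ?w Y)"
      by (simp add: sum_product sum.cartesian_product weight_def power_add case_prod_unfold)
    also have "\<dots> \<le> ?B * ?B"
      using sum_Pow_power_le[OF p C] p by (intro mult_mono sum_nonneg) auto
    finally show "(\<Sum>z\<in>F. p ^ weight z) \<le> ?B * ?B" .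
  qed
  hence "(\<lambda>z. norm (s ^ weight z)) summable_on states C" by (simp add: norm_power p_def)
  thus ?thesis by (rule abs_summable_summable)
qed

lemma has_sum_charge_gf:
  assumes "norm s < 1" "finite C"
  shows "((\<lambda>p. s ^ weight p) has_sum charge_gf C s m) (charge_states C m)"
  unfolding charge_gf_def
  by (intro has_sum_infsum summable_on_subset_banach[OF summable_on_states[OF assms]])
     (auto simp: charge_states_def)

text \<open>A state splits uniquely by colour into a part over \<open>C\<close> and a part over
  \<open>D\<close>. Charges and weights add, so the generating functions are convolved in the
  charge.\<close>

lemma charge_gf_union:
  assumes s: "norm s < 1" and C: "finite C" and D: "finite D" and disj: "C \<inter> D = {}"
  shows "((\<lambda>j. charge_gf C s j * charge_gf D s (m - j)) has_sum charge_gf (C \<union> D) s m) UNIV"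
proof -
  let ?T = "SIGMA j:UNIV. charge_states C j \<times> charge_states D (m - j)"
  define res :: "nat set \<Rightarrow> state \<Rightarrow> state" where
    "res C p = ({x \<in> fst p. snd x \<in> C}, {x \<in> snd p. snd x \<in> C})" for C p
  define cup :: "state \<Rightarrow> state \<Rightarrow> state" where
    "cup p p' = (fst p \<union> fst p', snd p \<union> snd p')" for p p'
  have res_states: "res A p \<in> states A" if "p \<in> states B" for A B p
    using that by (auto simp: states_def res_def)
  have cup_states: "cup p p' \<in> states (C \<union> D)" if "p \<in> states C" "p' \<in> states D" for p p'
    using that by (auto simp: states_def cup_def)
  have cup_res: "cup (res C p) (res D p) = p" if "p \<in> states (C \<union> D)" for p
    using that by (auto simp: states_def cup_def res_def)
  have res_cup: "res C (cup p p') = p" "res D (cup p p') = p'" if "p \<in> states C" "p' \<in> states D" for p p'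
    using that disj by (auto simp: states_def cup_def res_def)
  have disj_states: "fst p \<inter> fst p' = {}" "snd p \<inter> snd p' = {}"
    "finite (fst p)" "finite (fst p')" "finite (snd p)" "finite (snd p')"
    if "p \<in> states C" "p' \<in> states D" for p p'
    using that disj unfolding mem_states_iff by blast+
  have charge_cup: "charge (cup p p') = charge p + charge p'"
    and weight_cup: "weight (cup p p') = weight p + weight p'"
    if "p \<in> states C" "p' \<in> states D" for p p'
    using disj_states[OF that]
    by (simp_all add: charge_def weight_def cup_def card_Un_disjoint sum.union_disjoint)
  have "((\<lambda>p. s ^ weight p) has_sum charge_gf (C \<union> D) s m) (charge_states (C \<union> D) m)"
    using C D by (intro has_sum_charge_gf s) auto
  also have "?this \<longleftrightarrow> ((\<lambda>(j, p, p'). s ^ weight p * s ^ weight p') has_sum charge_gf (C \<union> D) s m) ?T"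
  \<comment> \<open>The charge of the \<open>C\<close>-part is carried along as a first component,
    so that the sum can afterwards be fibred over it.\<close>
  proof (rule has_sum_reindex_bij_witness
      [of _ "\<lambda>(j, p, p'). cup p p'" "\<lambda>p. (charge (res C p), res C p, res D p)"], goal_cases)
    case (1 p)
    thus ?case by (auto simp: charge_states_def cup_res)
  next
    case (2 p)
    hence p: "p \<in> states (C \<union> D)" "charge p = m" by (auto simp: charge_states_def)
    have "charge (res C p) + charge (res D p) = m"
      using charge_cup[of "res C p" "res D p"] res_states[OF p(1)] cup_res[OF p(1)] p(2) by simp
    thus ?case using res_states[OF p(1)] by (auto simp: charge_states_def)
  next
    case (3 x)
    thus ?case by (auto simp: charge_states_def res_cup)
  next
    case (4 x)
    thus ?case by (auto simp: charge_states_def charge_cup cup_states)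
  next
    case (5 p)
    hence p: "p \<in> states (C \<union> D)" by (auto simp: charge_states_def)
    show ?case
      using weight_cup[of "res C p" "res D p"] res_states[OF p(1)] cup_res[OF p(1)]
      by (simp add: power_add)
  qed simp
  finally have "((\<lambda>(j, p, p'). s ^ weight p * s ^ weight p') has_sum charge_gf (C \<union> D) s m) ?T" .
  thus ?thesis
  proof (rule has_sum_SigmaD)
    fix j :: int
    show "((\<lambda>y. case (j, y) of (j, p, p') \<Rightarrow> s ^ weight p * s ^ weight p') has_sum
      charge_gf C s j * charge_gf D s (m - j)) (charge_states C j \<times> charge_states D (m - j))"
      using has_sum_Times_complex[OF has_sum_charge_gf[OF s C] has_sum_charge_gf[OF s D]] by simp
  qed
qed

section \<open>One colour\<close>

text \<open>This is the coefficient of z^m in the truncated triple product, with a factor 1 + z s^(2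
  l + 1) for each entry of \<open>U\<close> and 1 + s^(2 l + 1) / z for each entry of
  \<open>V\<close>.\<close>

definition box_sum :: "complex \<Rightarrow> (nat \<times> nat) set \<Rightarrow> (nat \<times> nat) set \<Rightarrow> int \<Rightarrow> complex" where
  "box_sum s U V m = (\<Sum>p\<in>Pow U \<times> Pow V. if charge p = m then s ^ weight p else 0)"

lemma box_sum_swap: "box_sum s U V m = box_sum s V U (- m)"
  unfolding box_sum_def
  by (rule sum.reindex_bij_witness[of _ prod.swap prod.swap])
     (auto simp: charge_def weight_def add.commute)

text \<open>The upper set either omits \<open>x\<close> or contains it; in the second case removing
  \<open>x\<close> lowers the charge by 1 and the weight by \<open>2 * fst x + 1\<close>.\<close>

lemma box_sum_insert:
  assumes U: "finite U" "x \<notin> U" and V: "finite V"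
  shows "box_sum s (insert x U) V m = box_sum s U V m + s ^ (2 * fst x + 1) * box_sum s U V (m - 1)"
proof -
  let ?f = "\<lambda>m p. if charge p = m then s ^ weight p else 0"
  have fin: "finite X" if "X \<in> Pow U" for X
    using U that by (auto intro: finite_subset)
  have 1: "?f m (insert x X, Y) = s ^ (2 * fst x + 1) * ?f (m - 1) (X, Y)" if "X \<in> Pow U" for X Y
  proof -
    have "x \<notin> X" using that U by auto
    thus ?thesis using fin[OF that] by (auto simp: charge_def weight_def power_add)
  qed
  have inj: "inj_on (insert x) (Pow U)"
    using U by (auto simp: inj_on_def)
  have "box_sum s (insert x U) V m = (\<Sum>X\<in>Pow (insert x U). \<Sum>Y\<in>Pow V. ?f m (X, Y))"
    by (simp add: box_sum_def sum.cartesian_product)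
  also have "\<dots> = (\<Sum>X\<in>Pow U. \<Sum>Y\<in>Pow V. ?f m (X, Y)) + (\<Sum>X\<in>insert x ` Pow U. \<Sum>Y\<in>Pow V. ?f m (X, Y))"
    unfolding Pow_insert using U by (intro sum.union_disjoint) auto
  also have "(\<Sum>X\<in>Pow U. \<Sum>Y\<in>Pow V. ?f m (X, Y)) = box_sum s U V m"
    by (simp add: box_sum_def sum.cartesian_product)
  also have "(\<Sum>X\<in>insert x ` Pow U. \<Sum>Y\<in>Pow V. ?f m (X, Y)) =
      (\<Sum>X\<in>Pow U. \<Sum>Y\<in>Pow V. s ^ (2 * fst x + 1) * ?f (m - 1) (X, Y))"
    by (subst sum.reindex[OF inj], unfold o_def, intro sum.cong refl 1)
  also have "\<dots> = s ^ (2 * fst x + 1) * box_sum s U V (m - 1)"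
    by (subst box_sum_def)
       (simp only: sum_distrib_left [symmetric] sum.cartesian_product case_prod_unfold prod.collapse)
  finally show ?thesis .
qed

lemma box_sum_eq_0:
  assumes "finite U" "finite V" "m > int (card U) \<or> m < - int (card V)"
  shows "box_sum s U V m = 0"
proof -
  have "charge p \<noteq> m" if "p \<in> Pow U \<times> Pow V" for p
  proof -
    have "card (fst p) \<le> card U" "card (snd p) \<le> card V"
      using that assms by (auto intro: card_mono)
    thus ?thesis using assms(3) by (auto simp: charge_def)
  qed
  thus ?thesis by (simp add: box_sum_def)
qed

section \<open>The finite triple product and q-binomial coefficients\<close>

definition qpoch :: "complex \<Rightarrow> nat \<Rightarrow> complex" where
  "qpoch q n = (\<Prod>i<n. 1 - q * q ^ i)"

lemma qpoch_0 [simp]: "qpoch q 0 = 1"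
  and qpoch_Suc: "qpoch q (Suc n) = qpoch q n * (1 - q ^ Suc n)"
  by (simp_all add: qpoch_def)

text \<open>The truncated triple product has the coefficients \<open>s\<^bsup>m\<^sup>2\<^esup>\<close> times the \<open>q\<close>-binomial coefficient of
  \<open>a + b\<close> over \<open>b + m\<close>; here \<open>i = b + m\<close>, \<open>j = a - m\<close> and the denominators are cleared.\<close>

definition qbinomial_box :: "complex \<Rightarrow> nat \<Rightarrow> nat \<Rightarrow> nat \<Rightarrow> bool" where
  "qbinomial_box s c a b \<longleftrightarrow> (\<forall>i j. i + j = a + b \<longrightarrow>
     box_sum s ({..<a} \<times> {c}) ({..<b} \<times> {c}) (int i - int b) * (qpoch (s\<^sup>2) i * qpoch (s\<^sup>2) j) =
     s ^ nat ((int i - int b)\<^sup>2) * qpoch (s\<^sup>2) (a + b))"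

text \<open>The recursion for one new entry is the q-Pascal rule. With q = s^2 and cleared
  denominators it rests on (1 - q^j) + q^j (1 - q^i) = 1 - q^(i + j).\<close>

lemma qbinomial_box_Suc:
  assumes "qbinomial_box s c a b"
  shows "qbinomial_box s c (Suc a) b"
  unfolding qbinomial_box_def
proof (intro allI impI)
  fix i j assume ij: "i + j = Suc a + b"
  let ?K = "box_sum s ({..<a} \<times> {c}) ({..<b} \<times> {c})"
  let ?m = "int i - int b"
  let ?Q = "qpoch (s\<^sup>2)"
  note IH = assms[unfolded qbinomial_box_def, rule_format]
  have "{..<Suc a} \<times> {c} = insert (a, c) ({..<a} \<times> {c})" by auto
  hence K: "box_sum s ({..<Suc a} \<times> {c}) ({..<b} \<times> {c}) ?m = ?K ?m + s ^ (2 * a + 1) * ?K (?m - 1)"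
    by (simp add: box_sum_insert)
  consider "i = 0" | "j = 0" | i' j' where "i = Suc i'" "j = Suc j'"
    by (cases i; cases j) auto
  thus "box_sum s ({..<Suc a} \<times> {c}) ({..<b} \<times> {c}) ?m * (?Q i * ?Q j) = s ^ nat (?m\<^sup>2) * ?Q (Suc a + b)"
  proof cases
    case 1
    hence j: "j = Suc (a + b)" using ij by simp
    \<comment> \<open>Here m = -b, so m - 1 lies below every charge in the box.\<close>
    have "?K (?m - 1) = 0" using 1 by (intro box_sum_eq_0) auto
    moreover have "?K ?m * ?Q (a + b) = s ^ nat (?m\<^sup>2) * ?Q (a + b)"
      using IH[of 0 "a + b"] 1 by simp
    ultimately show ?thesis unfolding K using 1 by (simp add: j qpoch_Suc flip: mult.assoc)
  next
    case 2
    hence i: "i = Suc (a + b)" using ij by simp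
    \<comment> \<open>Now m = a + 1 exceeds every charge in the old box. Only the term with the new
      entry survives, and its weight 2 a + 1 is m^2 - (m - 1)^2.\<close>
    have "?K ?m = 0" using i by (intro box_sum_eq_0) auto
    moreover have "?K (?m - 1) * ?Q (a + b) = s ^ nat ((?m - 1)\<^sup>2) * ?Q (a + b)"
      using IH[of "a + b" 0] i by simp
    moreover have "2 * a + 1 + nat ((?m - 1)\<^sup>2) = nat (?m\<^sup>2)"
      using i by (intro int_int_eq[THEN iffD1], simp, simp add: power2_eq_square algebra_simps)
    ultimately have 0: "?K ?m = 0"
      and 1: "?K (?m - 1) * ?Q (a + b) = s ^ nat ((?m - 1)\<^sup>2) * ?Q (a + b)"
      and e: "s ^ (2 * a + 1) * s ^ nat ((?m - 1)\<^sup>2) = s ^ nat (?m\<^sup>2)"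
      by (simp_all only: power_add [symmetric])
    have "box_sum s ({..<Suc a} \<times> {c}) ({..<b} \<times> {c}) ?m * (?Q i * ?Q j) =
      s ^ (2 * a + 1) * (?K (?m - 1) * ?Q (a + b)) * (1 - (s\<^sup>2) ^ i)"
      unfolding K 0 2 by (simp only: i qpoch_Suc qpoch_0 ac_simps add_0 mult_1)
    also have "\<dots> = (s ^ (2 * a + 1) * s ^ nat ((?m - 1)\<^sup>2)) * (?Q (a + b) * (1 - (s\<^sup>2) ^ i))"
      unfolding 1 by (simp only: mult.assoc)
    also have "?Q (a + b) * (1 - (s\<^sup>2) ^ i) = ?Q (Suc a + b)"
      by (simp only: i add_Suc qpoch_Suc)
    finally show ?thesis unfolding e .
  next
    case 3
    have m1: "int i' - int b = ?m - 1" using 3 by simp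
    have 1: "?K ?m * (?Q i * ?Q j') = s ^ nat (?m\<^sup>2) * ?Q (a + b)"
      using IH[of i j'] ij 3 by simp
    have 2: "?K (?m - 1) * (?Q i' * ?Q j) = s ^ nat ((?m - 1)\<^sup>2) * ?Q (a + b)"
      using IH[of i' j] ij 3 unfolding m1 by simp
    \<comment> \<open>Since m = a + 1 - j, the difference of the squares falls short of 2 a + 1 by 2
      j; this supplies the factor q^j of the q-Pascal rule.\<close>
    have e: "2 * a + 1 + nat ((?m - 1)\<^sup>2) = nat (?m\<^sup>2) + 2 * j"
    proof (rule int_int_eq[THEN iffD1])
      have "int a = int i + int j - int b - 1" using ij by simp
      thus "int (2 * a + 1 + nat ((?m - 1)\<^sup>2)) = int (nat (?m\<^sup>2) + 2 * j)"
        by (simp, simp add: power2_eq_square algebra_simps)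
    qed
    have e': "s ^ (2 * a + 1) * s ^ nat ((?m - 1)\<^sup>2) = s ^ nat (?m\<^sup>2) * (s\<^sup>2) ^ j"
      using e by (metis power_add power_mult)
    have "box_sum s ({..<Suc a} \<times> {c}) ({..<b} \<times> {c}) ?m * (?Q i * ?Q j) =
      ?K ?m * (?Q i * ?Q j') * (1 - (s\<^sup>2) ^ j) + s ^ (2 * a + 1) * (?K (?m - 1) * (?Q i' * ?Q j)) * (1 - (s\<^sup>2) ^ i)"
      unfolding K using 3 by (simp only: qpoch_Suc) (simp only: algebra_simps)
    also have "\<dots> = s ^ nat (?m\<^sup>2) * ?Q (a + b) * (1 - (s\<^sup>2) ^ j)
       + (s ^ (2 * a + 1) * s ^ nat ((?m - 1)\<^sup>2)) * ?Q (a + b) * (1 - (s\<^sup>2) ^ i)"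
      unfolding 1 2 by (simp only: mult.assoc)
    also have "\<dots> = s ^ nat (?m\<^sup>2) * (?Q (a + b) * (1 - (s\<^sup>2) ^ (i + j)))"
      unfolding e' by (simp only: power_add) (simp only: algebra_simps mult_1)
    also have "?Q (a + b) * (1 - (s\<^sup>2) ^ (i + j)) = ?Q (Suc a + b)"
      using ij by (simp add: qpoch_Suc)
    finally show ?thesis .
  qed
qed

lemma qbinomial_box_swap:
  assumes "qbinomial_box s c a b"
  shows "qbinomial_box s c b a"
  unfolding qbinomial_box_def
proof (intro allI impI)
  fix i j assume ij: "i + j = b + a"
  have m: "int j - int b = - (int i - int a)" using ij by simp
  have "box_sum s ({..<a} \<times> {c}) ({..<b} \<times> {c}) (int j - int b) * (qpoch (s\<^sup>2) j * qpoch (s\<^sup>2) i) =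
     s ^ nat ((int j - int b)\<^sup>2) * qpoch (s\<^sup>2) (a + b)"
    using assms ij unfolding qbinomial_box_def by (metis add.commute)
  thus "box_sum s ({..<b} \<times> {c}) ({..<a} \<times> {c}) (int i - int a) * (qpoch (s\<^sup>2) i * qpoch (s\<^sup>2) j) =
     s ^ nat ((int i - int a)\<^sup>2) * qpoch (s\<^sup>2) (b + a)"
    unfolding m power2_minus box_sum_swap[of s "{..<b} \<times> {c}"] by (simp only: ac_simps)
qed

text \<open>Growing one side suffices: the upper box grows to size \<open>b\<close>, the rows are
  exchanged, and the new upper box grows to size \<open>a\<close>.\<close>

lemma qbinomial_box: "qbinomial_box s c a b"
proof -
  have "qbinomial_box s c 0 0"
    by (simp add: qbinomial_box_def box_sum_def charge_def weight_def)
  hence "qbinomial_box s c b 0" by (induction b) (auto intro: qbinomial_box_Suc)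
  hence "qbinomial_box s c 0 b" by (rule qbinomial_box_swap)
  thus ?thesis by (induction a) (auto intro: qbinomial_box_Suc)
qed

section \<open>Passage to the infinite triple product\<close>

lemma qpoch_tendsto:
  assumes q: "norm q < 1"
  shows "qpoch q \<longlonglongrightarrow> qpoch_inf q q" and "qpoch_inf q q \<noteq> 0" and "qpoch q n \<noteq> 0"
proof -
  have "summable (\<lambda>i. norm q * norm q ^ i)"
    using q by (intro summable_mult summable_geometric) simp
  hence "convergent_prod (\<lambda>i. 1 - q * q ^ i)"
    by (intro abs_convergent_prod_imp_convergent_prod summable_imp_abs_convergent_prod)
       (simp add: norm_mult norm_power)
  moreover have nz: "1 - q * q ^ i \<noteq> 0" for i
  proof
    assume "1 - q * q ^ i = 0"
    hence "norm (q ^ Suc i) = 1" by simp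
    thus False using power_less_one_iff[of "norm q" "Suc i"] q by (simp add: norm_power norm_mult del: power_Suc)
  qed
  ultimately have "(\<lambda>n. \<Prod>i\<le>n. 1 - q * q ^ i) \<longlonglongrightarrow> qpoch_inf q q" "qpoch_inf q q \<noteq> 0"
    unfolding qpoch_inf_def by (auto intro: convergent_prod_LIMSEQ dest: prodinf_nonzero)
  moreover have "(\<lambda>n. \<Prod>i\<le>n. 1 - q * q ^ i) = (\<lambda>n. qpoch q (Suc n))"
    by (simp only: qpoch_def lessThan_Suc_atMost)
  ultimately show "qpoch q \<longlonglongrightarrow> qpoch_inf q q" and "qpoch_inf q q \<noteq> 0"
    by (auto simp: filterlim_sequentially_Suc)
  show "qpoch q n \<noteq> 0" using nz by (simp add: qpoch_def)
qed

text \<open>The states in growing boxes eventually contain any given finite set of states, so they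
  are cofinal among the finite subsets and their sums converge to the unordered sum.\<close>

lemma box_sum_tendsto:
  assumes s: "norm s < 1"
  shows "(\<lambda>n. box_sum s ({..<n} \<times> {c}) ({..<n} \<times> {c}) m) \<longlonglongrightarrow> charge_gf {c} s m"
proof -
  define S where "S n = {p \<in> Pow ({..<n} \<times> {c}) \<times> Pow ({..<n} \<times> {c}). charge p = m}" for n :: nat
  have fin: "finite (S n)" for n by (simp add: S_def)
  have S_sub: "S n \<subseteq> charge_states {c} m" for n
  proof
    fix p assume p: "p \<in> S n"
    hence "fst p \<subseteq> {..<n} \<times> {c}" "snd p \<subseteq> {..<n} \<times> {c}" by (auto simp: S_def)
    moreover from this have "finite (fst p)" "finite (snd p)" by (auto intro: finite_subset)
    moreover have "charge p = m" using p by (simp add: S_def)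
    ultimately show "p \<in> charge_states {c} m"
      unfolding charge_states_def mem_states_iff by (auto simp: subset_iff)
  qed
  have box: "box_sum s ({..<n} \<times> {c}) ({..<n} \<times> {c}) m = (\<Sum>p\<in>S n. s ^ weight p)" for n
    unfolding box_sum_def S_def by (rule sum.inter_filter [symmetric]) simp
  have "filterlim S (finite_subsets_at_top (charge_states {c} m)) sequentially"
    unfolding filterlim_def le_filter_def eventually_filtermap eventually_finite_subsets_at_top
  proof (intro allI impI, elim exE conjE)
    fix P F assume F: "finite F" "F \<subseteq> charge_states {c} m"
      and P: "\<forall>Y. finite Y \<and> F \<subseteq> Y \<and> Y \<subseteq> charge_states {c} m \<longrightarrow> P Y"
    obtain N where N: "F \<subseteq> Pow ({..<N} \<times> {c}) \<times> Pow ({..<N} \<times> {c})"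
      using F finite_states_bounded[of F "{c}"] unfolding charge_states_def by blast
    have "P (S n)" if "n \<ge> N" for n
    proof -
      have "{..<N} \<times> {c} \<subseteq> {..<n} \<times> {c}" using that by auto
      hence "F \<subseteq> S n" using N F(2) unfolding S_def charge_states_def by blast
      thus ?thesis using P fin S_sub by blast
    qed
    thus "\<forall>\<^sub>F n in sequentially. P (S n)" by (auto simp: eventually_sequentially)
  qed
  thus ?thesis
    using has_sum_charge_gf[OF s, of "{c}" m] unfolding box has_sum_def
    by (auto intro: filterlim_compose)
qed

text \<open>In the box with a = b = n the coefficient is s^(m^2) times Q(2n) / (Q(n + m) Q(n - m)),
  where Q is \<open>qpoch\<close> at s^2. All three factors tend to the same nonzero infinite
  product, so one copy remains in the denominator.\<close>

lemma charge_gf_singleton: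
  assumes s: "norm s < 1"
  shows "charge_gf {c} s m = s ^ nat (m\<^sup>2) / qpoch_inf (s\<^sup>2) (s\<^sup>2)"
proof -
  let ?q = "s\<^sup>2"
  have q: "norm ?q < 1" using s by (simp add: norm_power power_less_one_iff)
  note Q = qpoch_tendsto[OF q]
  \<comment> \<open>The truncation by \<open>nat\<close> affects only finitely many n.\<close>
  have sub: "filterlim (\<lambda>n. nat (int n + k)) at_top sequentially" for k :: int
    unfolding filterlim_at_top eventually_sequentially
  proof
    fix Z :: nat
    show "\<exists>N. \<forall>n\<ge>N. Z \<le> nat (int n + k)" by (intro exI[of _ "nat (int Z - k)"]) auto
  qed
  have dbl: "filterlim (\<lambda>n::nat. n + n) at_top sequentially"
    unfolding filterlim_at_top eventually_sequentially by (meson le_add1 le_trans)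
  have "\<forall>\<^sub>F n in sequentially. s ^ nat (m\<^sup>2) * qpoch ?q (n + n) /
      (qpoch ?q (nat (int n + m)) * qpoch ?q (nat (int n + - m))) = box_sum s ({..<n} \<times> {c}) ({..<n} \<times> {c}) m"
    using eventually_ge_at_top[of "nat \<bar>m\<bar>"]
  proof eventually_elim
    case (elim n)
    have "nat (int n + m) + nat (int n + - m) = n + n" "int (nat (int n + m)) - int n = m"
      using elim by auto
    thus ?case
      using qbinomial_box[of s c n n, unfolded qbinomial_box_def, rule_format,
          of "nat (int n + m)" "nat (int n + - m)"] Q(3)
      by (simp add: field_simps)
  qed
  moreover have "(\<lambda>n. s ^ nat (m\<^sup>2) * qpoch ?q (n + n) /
      (qpoch ?q (nat (int n + m)) * qpoch ?q (nat (int n + - m)))) \<longlonglongrightarrow>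
      s ^ nat (m\<^sup>2) * qpoch_inf ?q ?q / (qpoch_inf ?q ?q * qpoch_inf ?q ?q)"
    using Q(2) by (intro tendsto_intros filterlim_compose[OF Q(1)] sub dbl) auto
  ultimately have "(\<lambda>n. box_sum s ({..<n} \<times> {c}) ({..<n} \<times> {c}) m) \<longlonglongrightarrow>
      s ^ nat (m\<^sup>2) * qpoch_inf ?q ?q / (qpoch_inf ?q ?q * qpoch_inf ?q ?q)"
    by (rule Lim_transform_eventually[rotated])
  from LIMSEQ_unique[OF box_sum_tendsto[OF s] this] show ?thesis
    using Q(2) by simp
qed

section \<open>Frobenius symbols as states of charge zero\<close>

lemma colored_less_irrefl: "\<not> colored_less x x"
  and colored_less_trans: "colored_less x y \<Longrightarrow> colored_less y z \<Longrightarrow> colored_less x z"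
  and colored_less_total: "x \<noteq> y \<Longrightarrow> colored_less x y \<or> colored_less y x"
  by (auto simp: colored_less_def prod_eq_iff)

text \<open>Both heads are the greatest element of the common set, hence equal; strictness allows
  them to be removed from it.\<close>

lemma sorted_colored_unique:
  assumes "sorted_wrt (\<lambda>x y. colored_less y x) xs" "sorted_wrt (\<lambda>x y. colored_less y x) ys"
    "set xs = set ys"
  shows "xs = ys"
  using assms
proof (induction xs arbitrary: ys)
  case Nil
  thus ?case by simp
next
  case (Cons x xs)
  then obtain y ys' where ys: "ys = y # ys'" by (cases ys) auto
  have "x = y"
    using Cons.prems unfolding ys
    by (metis colored_less_irrefl colored_less_trans list.set_intros(1) set_ConsD sorted_wrt.simps(2))
  moreover have "x \<notin> set xs" "y \<notin> set ys'"
    using Cons.prems colored_less_irrefl[of x] colored_less_irrefl[of y] unfolding ys by auto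
  ultimately have "set xs = set ys'"
    using Cons.prems(3) unfolding ys by (simp add: insert_ident)
  hence "xs = ys'" using Cons.prems(1,2) unfolding ys by (intro Cons.IH) simp_all
  thus ?case using \<open>x = y\<close> by (simp add: ys)
qed

lemma sorted_colored_distinct:
  "sorted_wrt (\<lambda>x y. colored_less y x) xs \<Longrightarrow> distinct xs"
  by (induction xs) (auto simp: colored_less_irrefl)

lemma sorted_colored_exists:
  assumes "finite X"
  shows "\<exists>xs. sorted_wrt (\<lambda>x y. colored_less y x) xs \<and> set xs = X"
  using assms
proof (induction X rule: finite_induct)
  case empty
  show ?case by (intro exI[of _ "[]"]) simp
next
  case (insert z X)
  then obtain xs where xs: "sorted_wrt (\<lambda>x y. colored_less y x) xs" "set xs = X" by blast
  let ?ys = "filter (colored_less z) xs @ z # filter (\<lambda>x. colored_less x z) xs"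
  have "sorted_wrt (\<lambda>x y. colored_less y x) ?ys"
    using xs(1) by (auto simp: sorted_wrt_append sorted_wrt_filter intro: colored_less_trans)
  moreover have "set ?ys = insert z X"
    using xs(2) insert.hyps(2) by (auto dest: colored_less_total)
  ultimately show ?case by blast
qed

text \<open>A strictly decreasing row is determined by its set of entries, and every finite set
  arises. Equal row lengths become charge 0.\<close>

lemma bij_betw_frobenius_symbols:
  "bij_betw (map_prod set set) (frobenius_symbols k) (charge_states {1..k} 0)"
  unfolding bij_betw_def
proof
  show "inj_on (map_prod set set) (frobenius_symbols k)"
    by (auto simp: inj_on_def frobenius_symbols_def frobenius_row_def intro: sorted_colored_unique)
  show "map_prod set set ` frobenius_symbols k = charge_states {1..k} 0"
  proof (intro equalityI subsetI)
    fix p assume "p \<in> map_prod set set ` frobenius_symbols k"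
    then obtain xs ys where p: "p = (set xs, set ys)" and z: "(xs, ys) \<in> frobenius_symbols k"
      by auto
    hence "distinct xs" "distinct ys"
      by (auto simp: frobenius_symbols_def frobenius_row_def intro: sorted_colored_distinct)
    hence "card (set xs) = length xs" "card (set ys) = length ys"
      by (simp_all add: distinct_card)
    thus "p \<in> charge_states {1..k} 0"
      using z unfolding p charge_states_def mem_states_iff charge_def frobenius_symbols_def frobenius_row_def
      by simp
  next
    fix p assume p: "p \<in> charge_states {1..k} 0"
    hence fin: "finite (fst p)" "finite (snd p)" by (simp_all add: charge_states_def mem_states_iff)
    obtain xs where xs: "sorted_wrt (\<lambda>x y. colored_less y x) xs" "set xs = fst p"
      using sorted_colored_exists[OF fin(1)] by blast
    obtain ys where ys: "sorted_wrt (\<lambda>x y. colored_less y x) ys" "set ys = snd p"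
      using sorted_colored_exists[OF fin(2)] by blast
    have "length xs = length ys"
      using p distinct_card[OF sorted_colored_distinct[OF xs(1)]]
        distinct_card[OF sorted_colored_distinct[OF ys(1)]]
      by (simp add: xs ys charge_states_def charge_def)
    hence "(xs, ys) \<in> frobenius_symbols k"
      using p xs ys by (simp add: frobenius_symbols_def frobenius_row_def charge_states_def mem_states_iff)
    moreover have "p = map_prod set set (xs, ys)" using xs ys by (simp add: prod_eq_iff)
    ultimately show "p \<in> map_prod set set ` frobenius_symbols k" by (rule rev_image_eqI)
  qed
qed

text \<open>Each of the two rows has d entries, so the summands 1 contribute 2 d in total.\<close>

lemma weight_frobenius_symbol:
  assumes "z \<in> frobenius_symbols k"
  shows "weight (map_prod set set z) = 2 * frobenius_size z"
proof -
  obtain xs ys where z: "z = (xs, ys)" by fastforce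
  have "distinct xs" "distinct ys" "length ys = length xs"
    using assms by (auto simp: z frobenius_symbols_def frobenius_row_def sorted_colored_distinct)
  moreover have "(\<Sum>x\<in>set zs. 2 * fst x + 1) = 2 * sum_list (map fst zs) + length zs"
    if "distinct zs" for zs :: "(nat \<times> nat) list"
    using that by (induction zs) auto
  ultimately show ?thesis by (simp add: z weight_def frobenius_size_def)
qed

text \<open>States of charge 0 are transported to symbols and grouped by size into finite fibres;
  doubled weights make the terms powers of s^2.\<close>

lemma cphi_sums_charge_gf:
  assumes s: "norm s < 1"
  shows "(\<lambda>n. of_nat (cphi k n) * (s\<^sup>2) ^ n) sums charge_gf {1..k} s 0"
proof -
  have "((\<lambda>p. s ^ weight p) has_sum charge_gf {1..k} s 0) (charge_states {1..k} 0)"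
    by (intro has_sum_charge_gf s) simp
  hence "((\<lambda>z. s ^ weight (map_prod set set z)) has_sum charge_gf {1..k} s 0) (frobenius_symbols k)"
    by (subst has_sum_reindex_bij_betw[OF bij_betw_frobenius_symbols])
  also have "?this \<longleftrightarrow> ((\<lambda>(n, z). (s\<^sup>2) ^ n) has_sum charge_gf {1..k} s 0)
      (SIGMA n:UNIV. frobenius_partitions k n)"
    by (rule has_sum_reindex_bij_witness[of _ snd "\<lambda>z. (frobenius_size z, z)"])
       (auto simp: frobenius_partitions_def weight_frobenius_symbol power_mult)
  finally have "((\<lambda>(n, z). (s\<^sup>2) ^ n) has_sum charge_gf {1..k} s 0)
      (SIGMA n:UNIV. frobenius_partitions k n)" .
  hence "((\<lambda>n. of_nat (cphi k n) * (s\<^sup>2) ^ n) has_sum charge_gf {1..k} s 0) UNIV"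
  proof (rule has_sum_SigmaD)
    fix n
    show "((\<lambda>z. case (n, z) of (n, z) \<Rightarrow> (s\<^sup>2) ^ n) has_sum of_nat (cphi k n) * (s\<^sup>2) ^ n)
        (frobenius_partitions k n)"
      by (intro has_sum_finiteI finite_frobenius_partitions) (simp add: cphi_def)
  qed
  thus ?thesis by (rule has_sum_imp_sums)
qed

section \<open>Doubling the number of colours\<close>

lemma card_split:
  assumes "card C = m + n" "m + n > 0"
  obtains A B where "C = A \<union> B" "A \<inter> B = {}" "card A = m" "card B = n" "finite A" "finite B"
proof -
  have fin: "finite C" using assms card_ge_0_finite by metis
  obtain A where A: "A \<subseteq> C" "card A = m" "finite A"
    using obtain_subset_with_card_n[of m C] assms by auto
  show ?thesis
    using A fin assms by (intro that[of A "C - A"]) (auto simp: card_Diff_subset)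
qed

text \<open>Both one-colour factors are Gaussians of base r^2, so completing the square leaves a
  Gaussian of base \<open>r\<close> and one theta constant. Here q = r^4.\<close>

lemma charge_gf_card_2:
  assumes r: "norm r < 1" and C: "card C = 2"
  shows "charge_gf C (r\<^sup>2) a = r ^ nat (a\<^sup>2) * theta_class a r / qpoch_inf (r ^ 4) (r ^ 4) ^ 2"
proof -
  let ?Q = "qpoch_inf (r ^ 4) (r ^ 4)"
  have r2: "norm (r\<^sup>2) < 1" using r by (simp add: norm_power power_less_one_iff)
  have Q: "qpoch_inf ((r\<^sup>2)\<^sup>2) ((r\<^sup>2)\<^sup>2) = ?Q" by (simp flip: power_mult)
  obtain c d where cd: "C = {c} \<union> {d}" "{c} \<inter> {d} = {}"
    using C by (auto simp: card_2_iff)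
  have "((\<lambda>b. charge_gf {c} (r\<^sup>2) b * charge_gf {d} (r\<^sup>2) (a - b)) has_sum charge_gf C (r\<^sup>2) a) UNIV"
    unfolding cd(1) using cd(2) by (intro charge_gf_union r2) auto
  moreover have "((\<lambda>b. (r\<^sup>2) ^ nat (b\<^sup>2) * (r\<^sup>2) ^ nat ((a - b)\<^sup>2) / ?Q\<^sup>2) has_sum
      r ^ nat (a\<^sup>2) * theta_class a r / ?Q\<^sup>2) UNIV"
    by (intro has_sum_divide_const has_sum_square_convolution r)
  moreover have "charge_gf {c} (r\<^sup>2) b * charge_gf {d} (r\<^sup>2) (a - b) =
      (r\<^sup>2) ^ nat (b\<^sup>2) * (r\<^sup>2) ^ nat ((a - b)\<^sup>2) / ?Q\<^sup>2" for b
    unfolding charge_gf_singleton[OF r2] Q by (simp add: power2_eq_square)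
  ultimately show ?thesis by (simp add: has_sum_unique)
qed

text \<open>The sum over b stays unevaluated because the parity of \<open>a\<close> decides how the
  two theta factors vary with b.\<close>

lemma charge_gf_card_4:
  assumes r: "norm r < 1" and C: "card C = 4"
  shows "((\<lambda>b. r ^ nat (b\<^sup>2) * r ^ nat ((a - b)\<^sup>2) * (theta_class b r * theta_class (a - b) r) /
    qpoch_inf (r ^ 4) (r ^ 4) ^ 4) has_sum charge_gf C (r\<^sup>2) a) UNIV"
proof -
  have r2: "norm (r\<^sup>2) < 1" using r by (simp add: norm_power power_less_one_iff)
  obtain A B where AB: "C = A \<union> B" "A \<inter> B = {}" "card A = 2" "card B = 2" "finite A" "finite B"
    using card_split[of C 2 2] C by auto
  have "((\<lambda>b. charge_gf A (r\<^sup>2) b * charge_gf B (r\<^sup>2) (a - b)) has_sum charge_gf C (r\<^sup>2) a) UNIV"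
    unfolding AB(1) using AB by (intro charge_gf_union r2) auto
  moreover have "charge_gf A (r\<^sup>2) b * charge_gf B (r\<^sup>2) (a - b) =
     r ^ nat (b\<^sup>2) * r ^ nat ((a - b)\<^sup>2) * (theta_class b r * theta_class (a - b) r) /
    qpoch_inf (r ^ 4) (r ^ 4) ^ 4" for b
    unfolding charge_gf_card_2[OF r AB(3)] charge_gf_card_2[OF r AB(4)]
    by (simp add: mult_ac flip: power_add)
  ultimately show ?thesis by simp
qed

text \<open>As b and 2 k - b have equal parity, the theta factors form a square that depends only on
  the parity of b; each parity class of b is summed separately.\<close>

lemma charge_gf_card_4_even:
  assumes r: "norm r < 1" and C: "card C = 4"
  shows "charge_gf C (r\<^sup>2) (2 * k) = (r\<^sup>2) ^ nat (k\<^sup>2) *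
    (theta_class 0 r ^ 2 * theta_class k (r\<^sup>2) + theta_class 1 r ^ 2 * theta_class (k + 1) (r\<^sup>2)) /
    qpoch_inf (r ^ 4) (r ^ 4) ^ 4" (is "_ = _ * (?E * _ + ?O * _) / ?Q")
proof -
  let ?f = "\<lambda>b. r ^ nat (b\<^sup>2) * r ^ nat ((2 * k - b)\<^sup>2)"
  let ?g = "\<lambda>b. ?f b * (theta_class b r * theta_class (2 * k - b) r) / ?Q"
  have E: "theta_class b r * theta_class (2 * k - b) r = ?E" if "even b" for b
    using that theta_class_even[of b r] theta_class_even[of "2 * k - b" r]
    by (simp add: power2_eq_square)
  have O: "theta_class b r * theta_class (2 * k - b) r = ?O" if "odd b" for b
    using that theta_class_odd[of b r] theta_class_odd[of "2 * k - b" r]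
    by (simp add: power2_eq_square)
  have "((\<lambda>b. ?f b * ?E / ?Q) has_sum
      (r\<^sup>2) ^ nat (k\<^sup>2) * theta_class (0 - k) (r\<^sup>2) * ?E / ?Q) {b. even b}"
    using has_sum_square_convolution_parity[OF r, of k 0]
    by (intro has_sum_divide_const has_sum_cmult_left) simp
  hence 0: "(?g has_sum (r\<^sup>2) ^ nat (k\<^sup>2) * theta_class (0 - k) (r\<^sup>2) * ?E / ?Q) {b. even b}"
    by (rule has_sum_cong[THEN iffD1, rotated]) (simp add: E)
  have "((\<lambda>b. ?f b * ?O / ?Q) has_sum
      (r\<^sup>2) ^ nat (k\<^sup>2) * theta_class (1 - k) (r\<^sup>2) * ?O / ?Q) {b. odd b}"
    using has_sum_square_convolution_parity[OF r, of k 1]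
    by (intro has_sum_divide_const has_sum_cmult_left) simp
  hence 1: "(?g has_sum (r\<^sup>2) ^ nat (k\<^sup>2) * theta_class (1 - k) (r\<^sup>2) * ?O / ?Q) {b. odd b}"
    by (rule has_sum_cong[THEN iffD1, rotated]) (simp add: O)
  \<comment> \<open>Only parity matters, so the sign of k may be changed.\<close>
  have p: "theta_class (0 - k) (r\<^sup>2) = theta_class k (r\<^sup>2)"
    "theta_class (1 - k) (r\<^sup>2) = theta_class (k + 1) (r\<^sup>2)"
    by (simp_all add: theta_class_def)
  from has_sum_unique[OF charge_gf_card_4[OF r C] has_sum_int_parity[OF 0 1]]
  show ?thesis unfolding p by (simp add: ring_distribs add_divide_distrib mult_ac)
qed

text \<open>As b and a - b have opposite parity, the theta factors are constant in b and the
  unrestricted convolution applies. It halves exponents once more, hence the base t with t^8 =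
  q.\<close>

lemma charge_gf_card_4_odd:
  assumes t: "norm t < 1" and C: "card C = 4" and a: "odd a"
  shows "charge_gf C (t ^ 4) a = t ^ nat (a\<^sup>2) *
    (theta_class 0 (t\<^sup>2) * theta_class 1 (t\<^sup>2) * theta_class 1 t) / qpoch_inf (t ^ 8) (t ^ 8) ^ 4"
proof -
  let ?r = "t\<^sup>2" and ?Q = "qpoch_inf (t ^ 8) (t ^ 8)"
  have r: "norm ?r < 1" using t by (simp add: norm_power power_less_one_iff)
  have pw: "?r\<^sup>2 = t ^ 4" "?r ^ 4 = t ^ 8" by (simp_all flip: power_mult)
  have "((\<lambda>b. ?r ^ nat (b\<^sup>2) * ?r ^ nat ((a - b)\<^sup>2) * (theta_class 0 ?r * theta_class 1 ?r) / ?Q ^ 4) has_sum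
      t ^ nat (a\<^sup>2) * theta_class a t * (theta_class 0 ?r * theta_class 1 ?r) / ?Q ^ 4) UNIV"
    by (intro has_sum_divide_const has_sum_cmult_left has_sum_square_convolution t)
  moreover have "theta_class b ?r * theta_class (a - b) ?r = theta_class 0 ?r * theta_class 1 ?r" for b
    using a theta_class_even[of b ?r] theta_class_even[of "a - b" ?r]
      theta_class_odd[of b ?r] theta_class_odd[of "a - b" ?r]
    by (cases "even b") simp_all
  ultimately have "((\<lambda>b. ?r ^ nat (b\<^sup>2) * ?r ^ nat ((a - b)\<^sup>2) *
      (theta_class b ?r * theta_class (a - b) ?r) / ?Q ^ 4) has_sum
      t ^ nat (a\<^sup>2) * theta_class a t * (theta_class 0 ?r * theta_class 1 ?r) / ?Q ^ 4) UNIV"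
    by (simp only:)
  from has_sum_unique[OF charge_gf_card_4[OF r C, of a, unfolded pw] this]
  show ?thesis by (simp add: theta_class_odd[OF a] mult_ac)
qed

text \<open>Charge 0 pairs charges a and -a of two four-colour halves, which have equal
  coefficients, so squares appear. Charges a = 2 k leave Gaussians (t^8)^(k^2), giving
  \<open>x\<close> for even k and \<open>y\<close> for odd k; odd a leave (t^2)^(a^2), giving
  \<open>B1\<close>.\<close>

lemma charge_gf_card_8:
  assumes t: "norm t < 1" and C: "card C = 8"
  defines "x \<equiv> theta_class 0 (t ^ 8)" and "y \<equiv> theta_class 1 (t ^ 8)"
    and "X \<equiv> theta_class 0 (t ^ 4)" and "Y \<equiv> theta_class 1 (t ^ 4)"
    and "B0 \<equiv> theta_class 0 (t\<^sup>2)" and "B1 \<equiv> theta_class 1 (t\<^sup>2)" and "Z \<equiv> theta_class 1 t"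
  shows "charge_gf C (t ^ 4) 0 =
    (x * (B0\<^sup>2 * X + B1\<^sup>2 * Y)\<^sup>2 + y * (B0\<^sup>2 * Y + B1\<^sup>2 * X)\<^sup>2 + B1 * (B0 * B1 * Z)\<^sup>2) /
    qpoch_inf (t ^ 8) (t ^ 8) ^ 8"
proof -
  let ?Q = "qpoch_inf (t ^ 8) (t ^ 8)"
  have small: "norm (t ^ Suc n) < 1" for n
    using t by (subst norm_power) (simp add: power_less_one_iff del: power_Suc)
  have t2: "norm (t\<^sup>2) < 1" and t4: "norm (t ^ 4) < 1" and t8: "norm (t ^ 8) < 1"
    using small[of 1] small[of 3] small[of 7] by (simp_all add: numeral_eq_Suc)
  have pw: "(t\<^sup>2)\<^sup>2 = t ^ 4" "(t\<^sup>2) ^ 4 = t ^ 8" "(t ^ 4)\<^sup>2 = t ^ 8" by (simp_all flip: power_mult)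
  obtain A B where AB: "C = A \<union> B" "A \<inter> B = {}" "card A = 4" "card B = 4" "finite A" "finite B"
    using card_split[of C 4 4] C by auto
  let ?h = "\<lambda>a. charge_gf A (t ^ 4) a * charge_gf B (t ^ 4) (0 - a)"
  have sum: "(?h has_sum charge_gf C (t ^ 4) 0) UNIV"
    unfolding AB(1) using AB by (intro charge_gf_union t4) auto
  \<comment> \<open>Squaring a coefficient squares the base of its Gaussian.\<close>
  have sq: "(u ^ n * v / ?Q ^ 4) * (u ^ n * v / ?Q ^ 4) = (u\<^sup>2) ^ n * (v\<^sup>2 / ?Q ^ 8)" for u v n
    by (simp add: power2_eq_square power_mult_distrib flip: power_add)
  note even4 = charge_gf_card_4_even[OF t2, unfolded pw, folded B0_def B1_def]
  have h_even: "?h (2 * k) = (t ^ 8) ^ nat (k\<^sup>2) *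
      ((B0\<^sup>2 * theta_class k (t ^ 4) + B1\<^sup>2 * theta_class (k + 1) (t ^ 4))\<^sup>2 / ?Q ^ 8)" for k
  proof -
    have "0 - 2 * k = 2 * (- k)" "theta_class (- k) = theta_class k" "theta_class (- k + 1) = theta_class (k + 1)"
      by (auto simp: theta_class_def fun_eq_iff)
    thus ?thesis
      by (simp only: even4[OF AB(3)] even4[OF AB(4)] power2_minus sq pw)
  qed
  have h_odd: "?h a = (t\<^sup>2) ^ nat (a\<^sup>2) * ((B0 * B1 * Z)\<^sup>2 / ?Q ^ 8)" if "odd a" for a
  proof -
    have "odd (- a)" using that by simp
    from charge_gf_card_4_odd[OF t AB(4) this] show ?thesis
      unfolding charge_gf_card_4_odd[OF t AB(3) that] B0_def B1_def Z_def diff_0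
      by (simp only: power2_minus sq)
  qed
  have XY_even: "theta_class k (t ^ 4) = X" "theta_class (k + 1) (t ^ 4) = Y" if "even k" for k
    unfolding X_def Y_def using that by (auto intro: theta_class_even theta_class_odd)
  have XY_odd: "theta_class k (t ^ 4) = Y" "theta_class (k + 1) (t ^ 4) = X" if "odd k" for k
    unfolding X_def Y_def using that by (auto intro: theta_class_even theta_class_odd)
  have "((\<lambda>k. ?h (2 * k)) has_sum x * ((B0\<^sup>2 * X + B1\<^sup>2 * Y)\<^sup>2 / ?Q ^ 8) + y * ((B0\<^sup>2 * Y + B1\<^sup>2 * X)\<^sup>2 / ?Q ^ 8)) UNIV"
  proof (rule has_sum_int_parity)
    have "((\<lambda>k. (t ^ 8) ^ nat (k\<^sup>2) * ((B0\<^sup>2 * X + B1\<^sup>2 * Y)\<^sup>2 / ?Q ^ 8)) has_sum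
        x * ((B0\<^sup>2 * X + B1\<^sup>2 * Y)\<^sup>2 / ?Q ^ 8)) {n. even n}"
      unfolding x_def by (intro has_sum_cmult_left has_sum_theta_classes t8)
    thus "((\<lambda>k. ?h (2 * k)) has_sum x * ((B0\<^sup>2 * X + B1\<^sup>2 * Y)\<^sup>2 / ?Q ^ 8)) {n. even n}"
      unfolding h_even
      by (rule has_sum_cong[THEN iffD1, rotated])
         (simp add: XY_even)
    have "((\<lambda>k. (t ^ 8) ^ nat (k\<^sup>2) * ((B0\<^sup>2 * Y + B1\<^sup>2 * X)\<^sup>2 / ?Q ^ 8)) has_sum
        y * ((B0\<^sup>2 * Y + B1\<^sup>2 * X)\<^sup>2 / ?Q ^ 8)) {n. odd n}"
      unfolding y_def by (intro has_sum_cmult_left has_sum_theta_classes t8)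
    thus "((\<lambda>k. ?h (2 * k)) has_sum y * ((B0\<^sup>2 * Y + B1\<^sup>2 * X)\<^sup>2 / ?Q ^ 8)) {n. odd n}"
      unfolding h_even
      by (rule has_sum_cong[THEN iffD1, rotated])
         (simp add: XY_odd)
  qed
  also have "?this \<longleftrightarrow> (?h has_sum x * ((B0\<^sup>2 * X + B1\<^sup>2 * Y)\<^sup>2 / ?Q ^ 8) + y * ((B0\<^sup>2 * Y + B1\<^sup>2 * X)\<^sup>2 / ?Q ^ 8)) {n. even n}"
    by (rule has_sum_reindex_bij_witness[of _ "\<lambda>n. n div 2" "\<lambda>n. 2 * n"]) auto
  finally have 0: "(?h has_sum x * ((B0\<^sup>2 * X + B1\<^sup>2 * Y)\<^sup>2 / ?Q ^ 8) + y * ((B0\<^sup>2 * Y + B1\<^sup>2 * X)\<^sup>2 / ?Q ^ 8)) {n. even n}" .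
  have "((\<lambda>a. (t\<^sup>2) ^ nat (a\<^sup>2) * ((B0 * B1 * Z)\<^sup>2 / ?Q ^ 8)) has_sum B1 * ((B0 * B1 * Z)\<^sup>2 / ?Q ^ 8)) {n. odd n}"
    unfolding B1_def by (intro has_sum_cmult_left has_sum_theta_classes t2)
  hence 1: "(?h has_sum B1 * ((B0 * B1 * Z)\<^sup>2 / ?Q ^ 8)) {n. odd n}"
    by (rule has_sum_cong[THEN iffD1, rotated]) (simp add: h_odd del: diff_0)
  from has_sum_unique[OF sum has_sum_int_parity[OF 0 1]] show ?thesis
    by (simp add: add_divide_distrib)
qed

section \<open>Elimination of the auxiliary theta constants\<close>

theorem theorem6p3:
  fixes q :: complex
  assumes "norm q < 1"
  shows "summable (\<lambda>n. of_nat (cphi 8 n) * q ^ n) \<and>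
    CPhi 8 q = 1 / (qpoch_inf q q) ^ 8 *
      (Theta3 (q ^ 4) ^ 7
       + 28 * Theta3 (q ^ 4) ^ 6 * Theta2_root q
       + 105 * Theta3 (q ^ 4) ^ 5 * Theta2_root q ^ 2
       + 112 * Theta3 (q ^ 4) ^ 4 * Theta2_root q ^ 3
       + 147 * Theta3 (q ^ 4) ^ 3 * Theta2_root q ^ 4
       + 84 * Theta3 (q ^ 4) ^ 2 * Theta2_root q ^ 5
       + 35 * Theta3 (q ^ 4) * Theta2_root q ^ 6)"
proof -
  \<comment> \<open>Any eighth root will do, since the result depends on t only through t^8.\<close>
  obtain t where q: "q = t ^ 8"
  proof -
    have "q = csqrt (csqrt (csqrt q)) ^ (2 * (2 * 2))" unfolding power_mult by simp
    thus ?thesis using that by simp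
  qed
  have t: "norm t < 1"
    using assms power_less_one_iff[of "norm t" 8] by (simp add: q norm_power)
  have small: "norm (t ^ Suc n) < 1" for n
    using t by (subst norm_power) (simp add: power_less_one_iff del: power_Suc)
  have t2: "norm (t\<^sup>2) < 1" and t4: "norm (t ^ 4) < 1"
    using small[of 1] small[of 3] by (simp_all add: numeral_eq_Suc)
  have pw: "(t\<^sup>2)\<^sup>2 = t ^ 4" "(t\<^sup>2) ^ 4 = t ^ 8" "(t ^ 4)\<^sup>2 = t ^ 8" by (simp_all flip: power_mult)
  define x y X Y B0 B1 Z where
    "x = theta_class 0 (t ^ 8)" and "y = theta_class 1 (t ^ 8)" and
    "X = theta_class 0 (t ^ 4)" and "Y = theta_class 1 (t ^ 4)" and
    "B0 = theta_class 0 (t\<^sup>2)" and "B1 = theta_class 1 (t\<^sup>2)" and "Z = theta_class 1 t"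
  note defs = x_def y_def X_def Y_def B0_def B1_def Z_def
  \<comment> \<open>These relations lead down to \<open>x\<close> and \<open>y\<close>, the
    constants at q itself. \<open>X\<close>, \<open>Y\<close>, \<open>B1\<close> and
    \<open>Z\<close> are known only through their squares, so odd powers of them must be combined
    first.\<close>
  have B0: "B0 = x + y" and B1: "B1\<^sup>2 = 2 * X * Y" and X: "X\<^sup>2 = x\<^sup>2 + y\<^sup>2"
    and Y: "Y\<^sup>2 = 2 * x * y" and Z: "Z\<^sup>2 = 2 * B0 * B1"
    using theta_class_add[OF t2] theta_class_1_square[OF t2] theta_class_0_square[OF t4]
      theta_class_1_square[OF t4] theta_class_1_square[OF t]
    unfolding defs pw by simp_all
  let ?P = "x ^ 7 + 28 * x ^ 6 * y + 105 * x ^ 5 * y ^ 2 + 112 * x ^ 4 * y ^ 3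
       + 147 * x ^ 3 * y ^ 4 + 84 * x ^ 2 * y ^ 5 + 35 * x * y ^ 6"
  \<comment> \<open>Replacing B1^2 by 2 X Y makes \<open>X\<close> a common factor inside the
    square; in the next line \<open>Y\<close> plays the same part.\<close>
  have 1: "(B0\<^sup>2 * X + B1\<^sup>2 * Y)\<^sup>2 = X\<^sup>2 * (B0\<^sup>2 + 2 * Y\<^sup>2)\<^sup>2"
    unfolding B1 by algebra
  have 2: "(B0\<^sup>2 * Y + B1\<^sup>2 * X)\<^sup>2 = Y\<^sup>2 * (B0\<^sup>2 + 2 * X\<^sup>2)\<^sup>2"
    unfolding B1 by algebra
  \<comment> \<open>The factor \<open>B1\<close> in Z^2 = 2 B0 B1 completes B1^3 to B1^4 = 4 X^2
    Y^2.\<close>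
  have 3: "B1 * (B0 * B1 * Z)\<^sup>2 = 8 * B0 ^ 3 * (X\<^sup>2 * Y\<^sup>2)"
  proof -
    have "B1 * (B0 * B1 * Z)\<^sup>2 = B1 * (B0\<^sup>2 * B1\<^sup>2 * Z\<^sup>2)" by (simp add: power_mult_distrib)
    also have "\<dots> = 2 * B0 ^ 3 * (B1\<^sup>2 * B1\<^sup>2)" unfolding Z by algebra
    also have "\<dots> = 8 * B0 ^ 3 * (X\<^sup>2 * Y\<^sup>2)" unfolding B1 by algebra
    finally show ?thesis .
  qed
  \<comment> \<open>Only B0, X^2 and Y^2 remain, so the claim is a polynomial identity in
    \<open>x\<close> and \<open>y\<close>. For instance 28 = 12 + 16, from the first and third
    summands.\<close>
  have P: "x * (B0\<^sup>2 * X + B1\<^sup>2 * Y)\<^sup>2 + y * (B0\<^sup>2 * Y + B1\<^sup>2 * X)\<^sup>2 + B1 * (B0 * B1 * Z)\<^sup>2 = ?P"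
    unfolding 1 2 3 unfolding X Y B0 by (simp add: eval_nat_numeral algebra_simps)
  have "charge_gf {1..8} (t ^ 4) 0 = ?P / qpoch_inf q q ^ 8"
    using charge_gf_card_8[OF t, of "{1..8}", folded defs] unfolding P q by simp
  moreover have "(\<lambda>n. of_nat (cphi 8 n) * q ^ n) sums charge_gf {1..8} (t ^ 4) 0"
    using cphi_sums_charge_gf[OF t4, of 8] unfolding pw q .
  ultimately have "(\<lambda>n. of_nat (cphi 8 n) * q ^ n) sums (?P / qpoch_inf q q ^ 8)" by simp
  moreover have "x = Theta3 (q ^ 4)" "y = Theta2_root q"
    unfolding defs Theta3_eq_theta_class Theta2_root_eq_theta_class q by simp_all
  ultimately show ?thesis
    unfolding CPhi_def by (simp add: sums_iff)
qed

end
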